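(* Let $A\in\mathbb{R}^{m\times n}$ with $2\le m<n$ be a matrix with nonzero columns such that either $\alpha(A)\le\frac{1}{\mu(A)}$ and $\beta(A)<\alpha(A)$, or $\alpha(A)<\frac{1}{\mu(A)}$. Let $b\in\mathbb{R}^m$. If the system $Ax=b$ has a solution $x$ obeying $$\|x\|_0<\frac12\left[1+\frac{2\left(1-\alpha(A)\beta(A)\widetilde{\mu}(A)^2\right)}{\mu^{(2)}(A)\left\{\widetilde{\mu}(A)(\alpha(A)+\beta(A))+\sqrt{\left[\widetilde{\mu}(A)(\alpha(A)-\beta(A))\right]^2+4}\right\}}\right],$$ where $\widetilde{\mu}(A):=\mu(A)-\mu^{(2)}(A)$, then $x$ is the unique sparsest solution to the linear system.
   Context: For a matrix $M\in\mathbb{R}^{m\times n}$ with nonzero columns $c_1,\dots,c_n$, put $g_{ij}=\frac{|c_i^Tc_j|}{\|c_i\|_2\|c_j\|_2}$. The mutual coherence is $\mu(M)=\max_{i\ne j}g_{ij}$. The sub-mutual coherence is $\mu^{(2)}(M)=\max\{g_{ij}: i\ne j,\ g_{ij}<\mu(M)\}$, the second largest distinct value among the $g_{ij}$, $i\neq j$ (convention: $0$ if this set is empty). It is known that $\mu^{(2)}(A)>0$ under the hypotheses of the claim. For $i=1,\dots,n$ let $\alpha_i(M)=|\{j: j\ne i,\ g_{ij}=\mu(M)\}|$. The coherence rank is $\alpha(M)=\max_{1\le i\le n}\alpha_i(M)$; let $i_0$ be an index with $\alpha_{i_0}(M)=\alpha(M)$; the sub-coherence rank is $\beta(M)=\max_{i\ne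 i_0}\alpha_i(M)$ (independent of the choice of $i_0$). $\|x\|_0$ is the number of nonzero components of $x$. A solution $x$ of $Ax=b$ is the unique sparsest solution if $\|x\|_0<\|y\|_0$ for every solution $y\ne x$ of $Ay=b$. *)

theory Defs
  imports "HOL-Analysis.Analysis"
begin

text \<open>An \<open>m \<times> n\<close> real matrix is an element of \<^typ>\<open>real ^ 'n ^ 'm\<close>, with \<open>m\<close> and \<open>n\<close> the
  cardinalities of the index types; \<^const>\<open>norm\<close> on \<^typ>\<open>real ^ 'm\<close> is the Euclidean norm.
  The maxima below are meaningful for matrices with at least two columns.\<close>

definition col_coherence :: "real ^ 'n ^ 'm \<Rightarrow> 'n \<Rightarrow> 'n \<Rightarrow> real" where
  "col_coherence M i j =
     \<bar>column i M \<bullet> column j M\<bar> / (norm (column i M) * norm (column j M))"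

definition mutual_coherence :: "real ^ 'n ^ 'm \<Rightarrow> real" where
  "mutual_coherence M = Max {col_coherence M i j | i j. i \<noteq> j}"

definition sub_mutual_coherence :: "real ^ 'n ^ 'm \<Rightarrow> real" where
  "sub_mutual_coherence M =
     (let S = {col_coherence M i j | i j. i \<noteq> j \<and> col_coherence M i j < mutual_coherence M}
      in if S = {} then 0 else Max S)"

definition coherence_count :: "real ^ 'n ^ 'm \<Rightarrow> 'n \<Rightarrow> nat" where
  "coherence_count M i = card {j. j \<noteq> i \<and> col_coherence M i j = mutual_coherence M}"

definition coherence_rank :: "real ^ 'n ^ 'm \<Rightarrow> nat" where
  "coherence_rank M = Max (range (coherence_count M))"

text \<open>The choice of the maximizing index \<open>i\<^sub>0\<close> is immaterial, see \<open>sub_coherence_rank_eq\<close>.\<close>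

definition sub_coherence_rank :: "real ^ 'n ^ 'm \<Rightarrow> nat" where
  "sub_coherence_rank M =
     (let i\<^sub>0 = (SOME i. coherence_count M i = coherence_rank M)
      in Max (coherence_count M ` {i. i \<noteq> i\<^sub>0}))"

lemma sub_coherence_rank_eq:
  fixes M :: "real ^ 'n ^ 'm"
  assumes k: "coherence_count M k = coherence_rank M"
  shows "sub_coherence_rank M = Max (coherence_count M ` {i. i \<noteq> k})"
proof -
  define l where "l = (SOME i. coherence_count M i = coherence_rank M)"
  have l: "coherence_count M l = coherence_rank M"
    unfolding l_def using k by (rule someI)
  have le: "coherence_count M i \<le> coherence_rank M" for i
    unfolding coherence_rank_def by (rule Max_ge) auto
  have max: "Max (coherence_count M ` {i. i \<noteq> p}) = coherence_rank M"
    if "q \<noteq> p" "coherence_count M q = coherence_rank M" for p q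
    by (rule Max_eqI) (use that le in force)+
  show ?thesis
  proof (cases "k = l")
    case True
    then show ?thesis by (simp add: sub_coherence_rank_def l_def)
  next
    case False
    then show ?thesis
      using max[of k l] max[of l k] k l by (simp add: sub_coherence_rank_def flip: l_def)
  qed
qed

definition l0_norm :: "real ^ 'n \<Rightarrow> nat" where
  "l0_norm x = card {i. x $ i \<noteq> 0}"

definition unique_sparsest_solution ::
    "real ^ 'n ^ 'm \<Rightarrow> real ^ 'm \<Rightarrow> real ^ 'n \<Rightarrow> bool" where
  "unique_sparsest_solution A b x \<longleftrightarrow>
     A *v x = b \<and> (\<forall>y. A *v y = b \<and> y \<noteq> x \<longrightarrow> l0_norm x < l0_norm y)"

end

theory Submission
  imports Defs
begin

text \<open>
  If a second solution \<open>y\<close> were as sparse as \<open>x\<close>, then \<open>z = y - x\<close> would be a nonzero kernel vector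
  of \<open>A\<close> whose support \<open>S\<close> has at most \<open>2 \<parallel>x\<parallel>\<^sub>0\<close> elements. The idea is to bound from below how many
  columns can be linearly dependent, as in Brauer's refinement of the Gershgorin theorem (ovals of
  Cassini) applied to the singular Gram matrix of the normalized columns indexed by \<open>S\<close>: there are
  two \<^emph>\<open>different\<close> rows whose off-diagonal absolute sums have product at least \<open>1\<close>
  (\<open>cassini_row_sums\<close>, fed by \<open>kernel_weight_le\<close>).

  A row sum of row \<open>i\<close> has \<open>card S - 1\<close> entries; each is at most \<open>\<mu>2\<close>, except for at most \<open>\<alpha>\<^sub>i\<close>
  (the coherence count of \<open>i\<close>) of them, which equal \<open>\<mu> = \<mu>2 + \<mu>t\<close>. So with
  \<open>s = (card S - 1) \<mu>2\<close> the sum is at most \<open>\<alpha>\<^sub>i \<mu>t + s\<close>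
  (\<open>coherence_row_sum_le\<close>). Since the two rows differ, only one of them can have a count exceeding
  \<open>\<beta>\<close> (\<open>coherence_count_pair_le\<close>), whence \<open>1 \<le> (\<alpha> \<mu>t + s) (\<beta> \<mu>t + s)\<close>. Thus \<open>s\<close> is at least the
  larger root of a quadratic polynomial (\<open>larger_root_le\<close>), and that root, divided by \<open>\<mu>2\<close>, is the
  fraction in the sparsity bound; this contradicts \<open>card S \<le> 2 \<parallel>x\<parallel>\<^sub>0\<close>.

  When \<open>\<mu>2 = 0\<close> the fraction is \<open>0\<close> by the convention for division by zero, so the bound forces
  \<open>x = 0\<close>, for which the claim is immediate.
\<close>

section \<open>Row sums of a singular matrix\<close>

text \<open>This is Brauer's eigenvalue inclusion at the eigenvalue \<open>0\<close>, reduced to its combinatorial core: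
  \<open>w\<close> holds the moduli of a kernel vector on its support and \<open>g\<close> the moduli of the entries
  of a matrix with unit diagonal.
  The two rows are those of the largest and the second largest weight; each of these two weights is
  at most the other one times its row sum.\<close>

lemma cassini_row_sums:
  fixes g :: "'a \<Rightarrow> 'a \<Rightarrow> real" and w :: "'a \<Rightarrow> real"
  assumes fin: "finite S" and ne: "S \<noteq> {}"
    and pos: "\<And>i. i \<in> S \<Longrightarrow> 0 < w i"
    and g0: "\<And>i j. 0 \<le> g i j"
    and dom: "\<And>i. i \<in> S \<Longrightarrow> w i \<le> (\<Sum>j\<in>S - {i}. g i j * w j)"
  obtains i j where "i \<in> S" "j \<in> S" "i \<noteq> j"
    "1 \<le> (\<Sum>k\<in>S - {i}. g i k) * (\<Sum>k\<in>S - {j}. g j k)"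
proof -
  have max_weight: "\<exists>i\<in>T. \<forall>k\<in>T. w k \<le> w i" if T: "finite T" "T \<noteq> {}" for T
  proof -
    obtain i where "i \<in> T" "Max (w ` T) = w i"
      using obtains_MAX[OF T] .
    moreover have "\<forall>k\<in>T. w k \<le> Max (w ` T)"
      using T by simp
    ultimately show ?thesis by auto
  qed
  from max_weight[OF fin ne]
  obtain i where i: "i \<in> S" and i_max: "\<And>k. k \<in> S \<Longrightarrow> w k \<le> w i"
    by blast
  have "S - {i} \<noteq> {}"
  proof
    assume "S - {i} = {}"
    then have "w i \<le> 0" using dom[OF i] by (simp only: sum.empty)
    then show False using pos[OF i] by simp
  qed
  then obtain j where j: "j \<in> S" "j \<noteq> i" and j_max: "\<And>k. k \<in> S - {i} \<Longrightarrow> w k \<le> w j"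
    using max_weight[of "S - {i}"] fin by auto
  define R where "R i = (\<Sum>k\<in>S - {i}. g i k)" for i
  have R0: "0 \<le> R k" for k
    by (simp add: R_def g0 sum_nonneg)
  have "w i \<le> R i * w j"
  proof -
    have "(\<Sum>k\<in>S - {i}. g i k * w k) \<le> (\<Sum>k\<in>S - {i}. g i k * w j)"
      by (intro sum_mono mult_left_mono j_max g0)
    then show ?thesis using dom[OF i] by (simp add: R_def sum_distrib_right)
  qed
  moreover have "w j \<le> R j * w i"
  proof -
    have "(\<Sum>k\<in>S - {j}. g j k * w k) \<le> (\<Sum>k\<in>S - {j}. g j k * w i)"
      by (intro sum_mono mult_left_mono i_max g0) simp
    then show ?thesis using dom[OF j(1)] by (simp add: R_def sum_distrib_right)
  qed
  ultimately have "w i \<le> R i * (R j * w i)"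
    by (meson R0 mult_left_mono order_trans)
  then have "1 \<le> R i * R j"
    using pos[OF i] by (simp add: mult.assoc[symmetric])
  then show thesis
    using that i j unfolding R_def by blast
qed

section \<open>Coherences and Gram matrix rows\<close>

lemma col_coherence_nonneg: "0 \<le> col_coherence M i j"
  by (simp add: col_coherence_def)

text \<open>Row \<open>i\<close> of the equation \<open>G w = 0\<close> for the Gram matrix \<open>G\<close> of the normalized columns: rescaling
  the columns to unit length turns the kernel vector \<open>z\<close> into \<open>z\<^sub>j \<parallel>c\<^sub>j\<parallel>\<close> and makes the coherences the
  moduli of the off-diagonal entries.\<close>

lemma kernel_weight_le:
  fixes A :: "real ^ 'n ^ 'm"
  assumes nz: "\<And>j. column j A \<noteq> 0" and ker: "A *v z = 0"
  shows "\<bar>z $ i\<bar> * norm (column i A)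
    \<le> (\<Sum>j\<in>{j. z $ j \<noteq> 0} - {i}. col_coherence A i j * (\<bar>z $ j\<bar> * norm (column j A)))"
proof -
  let ?c = "\<lambda>j. column j A"
  have "0 = ?c i \<bullet> (\<Sum>j\<in>UNIV. z $ j *\<^sub>R ?c j)"
    using ker by (simp add: matrix_mult_sum scalar_mult_eq_scaleR)
  also have "\<dots> = (\<Sum>j\<in>UNIV. z $ j * (?c i \<bullet> ?c j))"
    by (simp add: inner_sum_right)
  also have "\<dots> = z $ i * (norm (?c i))\<^sup>2 + (\<Sum>j\<in>UNIV - {i}. z $ j * (?c i \<bullet> ?c j))"
    by (subst sum.remove[of _ i]) (auto simp: power2_norm_eq_inner)
  also have "(\<Sum>j\<in>UNIV - {i}. z $ j * (?c i \<bullet> ?c j))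
      = (\<Sum>j\<in>{j. z $ j \<noteq> 0} - {i}. z $ j * (?c i \<bullet> ?c j))"
    by (rule sum.mono_neutral_right) auto
  finally have row: "z $ i * (norm (?c i))\<^sup>2 = - (\<Sum>j\<in>{j. z $ j \<noteq> 0} - {i}. z $ j * (?c i \<bullet> ?c j))"
    by (simp add: eq_neg_iff_add_eq_0)
  have "\<bar>z $ i\<bar> * (norm (?c i))\<^sup>2 = \<bar>z $ i * (norm (?c i))\<^sup>2\<bar>"
    by (simp add: abs_mult)
  also have "\<dots> = \<bar>\<Sum>j\<in>{j. z $ j \<noteq> 0} - {i}. z $ j * (?c i \<bullet> ?c j)\<bar>"
    by (simp only: row abs_minus_cancel)
  also have "\<dots> \<le> (\<Sum>j\<in>{j. z $ j \<noteq> 0} - {i}. \<bar>z $ j * (?c i \<bullet> ?c j)\<bar>)"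
    by (rule sum_abs)
  also have "\<dots> = norm (?c i) *
      (\<Sum>j\<in>{j. z $ j \<noteq> 0} - {i}. col_coherence A i j * (\<bar>z $ j\<bar> * norm (?c j)))"
    unfolding sum_distrib_left
    by (intro sum.cong) (auto simp: col_coherence_def abs_mult nz)
  finally have "norm (?c i) * (\<bar>z $ i\<bar> * norm (?c i)) \<le> norm (?c i) *
      (\<Sum>j\<in>{j. z $ j \<noteq> 0} - {i}. col_coherence A i j * (\<bar>z $ j\<bar> * norm (?c j)))"
    by (simp add: power2_eq_square mult_ac)
  then show ?thesis
    using nz[of i] by simp
qed

lemma finite_coherences: "finite {col_coherence M i j | i j. P i j}"
  for M :: "real ^ 'n ^ 'm"
  by (rule finite_subset[of _ "range (\<lambda>(i, j). col_coherence M i j)"]) auto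

lemma col_coherence_le_mutual: "i \<noteq> j \<Longrightarrow> col_coherence M i j \<le> mutual_coherence M"
  unfolding mutual_coherence_def by (rule Max_ge[OF finite_coherences]) auto

lemma col_coherence_le_sub_mutual:
  assumes "i \<noteq> j" "col_coherence M i j < mutual_coherence M"
  shows "col_coherence M i j \<le> sub_mutual_coherence M"
proof -
  let ?S = "{col_coherence M i j | i j. i \<noteq> j \<and> col_coherence M i j < mutual_coherence M}"
  have "col_coherence M i j \<in> ?S" using assms by auto
  moreover from this have "col_coherence M i j \<le> Max ?S"
    by (rule Max_ge[OF finite_coherences])
  ultimately show ?thesis unfolding sub_mutual_coherence_def Let_def by auto
qed

lemma sub_mutual_coherence_bounds:
  fixes M :: "real ^ 'n ^ 'm" and i j :: 'n
  assumes "i \<noteq> j"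
  shows "0 \<le> sub_mutual_coherence M" "sub_mutual_coherence M \<le> mutual_coherence M"
proof -
  let ?S = "{col_coherence M i j | i j. i \<noteq> j \<and> col_coherence M i j < mutual_coherence M}"
  have mu: "0 \<le> mutual_coherence M"
    using col_coherence_nonneg col_coherence_le_mutual[OF assms] by (rule order_trans)
  have "?S = {} \<and> sub_mutual_coherence M = 0 \<or> sub_mutual_coherence M \<in> ?S"
    using Max_in[OF finite_coherences, of M "\<lambda>i j. i \<noteq> j \<and> col_coherence M i j < mutual_coherence M"]
    unfolding sub_mutual_coherence_def Let_def by (simp only: split: if_split) blast
  then show "0 \<le> sub_mutual_coherence M" "sub_mutual_coherence M \<le> mutual_coherence M"
    using mu col_coherence_nonneg[of M] by fastforce+
qed

text \<open>Each entry is \<open>\<mu>2\<close> plus a surplus of at most \<open>\<mu> - \<mu>2\<close>, and the surplus is needed only where the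
  maximum \<open>\<mu>\<close> is attained. The second index \<open>j\<close> certifies that there is a pair of distinct columns,
  without which \<open>\<mu>\<close> would be the maximum of an empty set.\<close>

lemma coherence_row_sum_le:
  fixes M :: "real ^ 'n ^ 'm"
  assumes i: "i \<in> S" and other: "j \<noteq> i"
  shows "(\<Sum>k\<in>S - {i}. col_coherence M i k)
    \<le> real (coherence_count M i) * (mutual_coherence M - sub_mutual_coherence M)
      + (real (card S) - 1) * sub_mutual_coherence M"
proof -
  let ?\<mu> = "mutual_coherence M" and ?\<mu>2 = "sub_mutual_coherence M"
  let ?T = "{k. k \<noteq> i \<and> col_coherence M i k = ?\<mu>}"
  have "(\<Sum>k\<in>S - {i}. col_coherence M i k)
      \<le> (\<Sum>k\<in>S - {i}. ?\<mu>2 + (if k \<in> ?T then ?\<mu> - ?\<mu>2 else 0))"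
  proof (rule sum_mono)
    fix k assume k: "k \<in> S - {i}"
    then have "col_coherence M i k \<le> ?\<mu>"
      by (intro col_coherence_le_mutual) auto
    then show "col_coherence M i k \<le> ?\<mu>2 + (if k \<in> ?T then ?\<mu> - ?\<mu>2 else 0)"
      using col_coherence_le_sub_mutual[of i k M] k by auto
  qed
  also have "\<dots> = real (card (S - {i})) * ?\<mu>2 + real (card ((S - {i}) \<inter> ?T)) * (?\<mu> - ?\<mu>2)"
    by (simp add: sum.distrib sum.inter_restrict[symmetric] del: mem_Collect_eq)
  also have "real (card ((S - {i}) \<inter> ?T)) * (?\<mu> - ?\<mu>2)
      \<le> real (coherence_count M i) * (?\<mu> - ?\<mu>2)"
    unfolding coherence_count_def
    by (intro mult_right_mono of_nat_mono card_mono)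
       (auto simp: sub_mutual_coherence_bounds(2)[OF other])
  also have "real (card (S - {i})) = real (card S) - 1"
  proof -
    have "card S = Suc (card (S - {i}))" using i by (intro card.remove) auto
    then show ?thesis by simp
  qed
  finally show ?thesis by simp
qed

text \<open>The reason for introducing the sub-coherence rank: at most one index has a count above it.\<close>

lemma coherence_count_pair_le:
  fixes M :: "real ^ 'n ^ 'm"
  assumes "i \<noteq> j"
  shows "coherence_count M i \<le> coherence_rank M \<and> coherence_count M j \<le> sub_coherence_rank M
    \<or> coherence_count M i \<le> sub_coherence_rank M \<and> coherence_count M j \<le> coherence_rank M"
proof -
  have le: "coherence_count M k \<le> coherence_rank M" for k
    unfolding coherence_rank_def by (rule Max_ge) auto
  have "coherence_rank M \<in> range (coherence_count M)"
    unfolding coherence_rank_def by (rule Max_in) auto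
  then obtain p where p: "coherence_count M p = coherence_rank M" by auto
  have "coherence_count M k \<le> sub_coherence_rank M" if "k \<noteq> p" for k
    unfolding sub_coherence_rank_eq[OF p] by (rule Max_ge) (use that in auto)
  with le assms show ?thesis by metis
qed

section \<open>Sparsity of kernel vectors and uniqueness\<close>

text \<open>The left-hand side is the larger root of \<open>(p + X) (q + X) - 1\<close>, with the numerator of the usual
  formula \<open>(- (p + q) + sqrt ((p - q)\<^sup>2 + 4)) / 2\<close> rationalized. The smaller root is negative, so the
  polynomial can be nonnegative at \<open>s \<ge> 0\<close> only if \<open>s\<close> has reached the larger one.\<close>

lemma larger_root_le:
  fixes p q s :: real
  assumes p: "0 \<le> p" and q: "0 \<le> q" and s: "0 \<le> s" and one: "1 \<le> (p + s) * (q + s)"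
  shows "2 * (1 - p * q) / (p + q + sqrt ((p - q)\<^sup>2 + 4)) \<le> s"
proof -
  define D where "D = sqrt ((p - q)\<^sup>2 + 4)"
  have D2: "D\<^sup>2 = (p - q)\<^sup>2 + 4" by (simp add: D_def)
  have "0 < D" by (simp add: D_def add_nonneg_pos)
  have pos: "0 < p + q + D" using p q \<open>0 < D\<close> by simp
  have "0 \<le> 4 * ((p + s) * (q + s) - 1)" using one by simp
  also have "\<dots> = (2 * s + p + q + D) * (2 * s + p + q - D)"
    using D2 by (simp add: power2_eq_square algebra_simps)
  finally have root: "D - (p + q) \<le> 2 * s"
    using pos s by (simp add: zero_le_mult_iff)
  have "4 * (1 - p * q) = (D - (p + q)) * (p + q + D)"
    using D2 by (simp add: power2_eq_square algebra_simps)
  also have "\<dots> \<le> 2 * s * (p + q + D)"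
    using root pos by (intro mult_right_mono) auto
  finally show ?thesis
    unfolding D_def[symmetric] using pos by (simp add: pos_divide_le_eq)
qed

text \<open>In effect a lower bound on the spark of the matrix, the least number of linearly dependent
  columns. Keeping \<open>\<mu>2\<close> as a factor on the right makes it valid for \<open>\<mu>2 = 0\<close> as well.\<close>

lemma kernel_l0_norm_ge:
  fixes A :: "real ^ 'n ^ 'm"
  defines "\<alpha> \<equiv> real (coherence_rank A)"
    and "\<beta> \<equiv> real (sub_coherence_rank A)"
    and "\<mu>2 \<equiv> sub_mutual_coherence A"
    and "\<mu>t \<equiv> mutual_coherence A - sub_mutual_coherence A"
  assumes nz: "\<And>j. column j A \<noteq> 0" and ker: "A *v z = 0" and z: "z \<noteq> 0"
  shows "2 * (1 - \<alpha> * \<beta> * \<mu>t\<^sup>2) / (\<mu>t * (\<alpha> + \<beta>) + sqrt ((\<mu>t * (\<alpha> - \<beta>))\<^sup>2 + 4))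
    \<le> (real (l0_norm z) - 1) * \<mu>2"
proof -
  define S where "S = {j. z $ j \<noteq> 0}"
  define s where "s = (real (card S) - 1) * \<mu>2"
  have S: "finite S" "S \<noteq> {}" using z by (auto simp: S_def vec_eq_iff)
  obtain i j where ij: "i \<in> S" "j \<in> S" "i \<noteq> j"
    and one: "1 \<le> (\<Sum>k\<in>S - {i}. col_coherence A i k) * (\<Sum>k\<in>S - {j}. col_coherence A j k)"
  proof (rule cassini_row_sums[OF S])
    show "0 < \<bar>z $ k\<bar> * norm (column k A)" if "k \<in> S" for k
      using that nz by (simp add: S_def)
    show "\<bar>z $ k\<bar> * norm (column k A)
        \<le> (\<Sum>j\<in>S - {k}. col_coherence A k j * (\<bar>z $ j\<bar> * norm (column j A)))" for k
      unfolding S_def by (rule kernel_weight_le[OF nz ker])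
  qed (auto simp: col_coherence_nonneg)
  have \<mu>: "0 \<le> \<mu>2" "0 \<le> \<mu>t"
    using sub_mutual_coherence_bounds[OF ij(3), of A] by (auto simp: \<mu>2_def \<mu>t_def)
  have "1 \<le> card S" using S by (simp add: Suc_le_eq card_gt_0_iff)
  then have s: "0 \<le> s" unfolding s_def using \<mu> by (intro mult_nonneg_nonneg) simp_all
  have row: "(\<Sum>k\<in>S - {k'}. col_coherence A k' k) \<le> real (coherence_count A k') * \<mu>t + s"
    if "k' \<in> S" "k' \<noteq> l" for k' l
    unfolding s_def \<mu>t_def \<mu>2_def using that by (intro coherence_row_sum_le[of _ _ l]) auto
  have "1 \<le> (real (coherence_count A i) * \<mu>t + s) * (real (coherence_count A j) * \<mu>t + s)"
    by (rule order_trans[OF one])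
       (intro mult_mono row[of i j] row[of j i] sum_nonneg, use ij \<mu> s in \<open>auto simp: col_coherence_nonneg\<close>)
  also have "\<dots> \<le> (\<alpha> * \<mu>t + s) * (\<beta> * \<mu>t + s)"
    using coherence_count_pair_le[OF ij(3), of A]
  proof
    assume "coherence_count A i \<le> coherence_rank A \<and> coherence_count A j \<le> sub_coherence_rank A"
    then show ?thesis unfolding \<alpha>_def \<beta>_def
      using \<mu> s by (intro mult_mono add_right_mono mult_right_mono) auto
  next
    assume "coherence_count A i \<le> sub_coherence_rank A \<and> coherence_count A j \<le> coherence_rank A"
    then show ?thesis unfolding \<alpha>_def \<beta>_def
      using \<mu> s by (subst mult.commute, intro mult_mono add_right_mono mult_right_mono) auto
  qed
  finally have "2 * (1 - (\<alpha> * \<mu>t) * (\<beta> * \<mu>t)) /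
      (\<alpha> * \<mu>t + \<beta> * \<mu>t + sqrt ((\<alpha> * \<mu>t - \<beta> * \<mu>t)\<^sup>2 + 4)) \<le> s"
    using \<mu> s by (intro larger_root_le) (auto simp: \<alpha>_def \<beta>_def)
  moreover have "(\<alpha> * \<mu>t) * (\<beta> * \<mu>t) = \<alpha> * \<beta> * \<mu>t\<^sup>2"
    "\<alpha> * \<mu>t + \<beta> * \<mu>t = \<mu>t * (\<alpha> + \<beta>)" "\<alpha> * \<mu>t - \<beta> * \<mu>t = \<mu>t * (\<alpha> - \<beta>)"
    by (simp_all add: power2_eq_square algebra_simps)
  ultimately show ?thesis
    by (simp add: s_def S_def l0_norm_def)
qed

lemma l0_norm_eq_0_iff: "l0_norm x = 0 \<longleftrightarrow> x = 0"
  by (auto simp: l0_norm_def vec_eq_iff)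

lemma l0_norm_diff_le: "l0_norm (x - y) \<le> l0_norm x + l0_norm y"
proof -
  have "l0_norm (x - y) \<le> card ({i. x $ i \<noteq> 0} \<union> {i. y $ i \<noteq> 0})"
    unfolding l0_norm_def by (intro card_mono) auto
  also have "\<dots> \<le> l0_norm x + l0_norm y"
    unfolding l0_norm_def by (rule card_Un_le)
  finally show ?thesis .
qed

theorem theorem2p9:
  fixes A :: "real ^ 'n ^ 'm" and b :: "real ^ 'm" and x :: "real ^ 'n"
    and \<alpha> \<beta> \<mu> \<mu>2 \<mu>t :: real
  defines "\<alpha> \<equiv> real (coherence_rank A)"
    and "\<beta> \<equiv> real (sub_coherence_rank A)"
    and "\<mu> \<equiv> mutual_coherence A"
    and "\<mu>2 \<equiv> sub_mutual_coherence A"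
    and "\<mu>t \<equiv> \<mu> - \<mu>2"
  assumes "2 \<le> CARD('m)" and "CARD('m) < CARD('n)"
    and "\<And>j. column j A \<noteq> 0"
    and "(\<alpha> \<le> 1 / \<mu> \<and> \<beta> < \<alpha>) \<or> \<alpha> < 1 / \<mu>"
    and "A *v x = b"
    and "real (l0_norm x) <
           1 / 2 * (1 + 2 * (1 - \<alpha> * \<beta> * \<mu>t\<^sup>2) /
             (\<mu>2 * (\<mu>t * (\<alpha> + \<beta>) + sqrt ((\<mu>t * (\<alpha> - \<beta>))\<^sup>2 + 4))))"
  shows "unique_sparsest_solution A b x"
proof -
  note nz = assms(8) and sol = assms(10)
  define Q where "Q = 2 * (1 - \<alpha> * \<beta> * \<mu>t\<^sup>2) / (\<mu>t * (\<alpha> + \<beta>) + sqrt ((\<mu>t * (\<alpha> - \<beta>))\<^sup>2 + 4))"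
  have sparse: "2 * real (l0_norm x) < 1 + Q / \<mu>2"
    using assms(11) by (simp add: Q_def mult.commute)
  have "l0_norm x < l0_norm y" if y: "A *v y = b" "y \<noteq> x" for y
  proof (cases "\<mu>2 = 0")
    case True
    then have "x = 0" using sparse by (simp flip: l0_norm_eq_0_iff)
    then show ?thesis using y l0_norm_eq_0_iff[of y] l0_norm_eq_0_iff[of x] by simp
  next
    case False
    have "A *v (y - x) = 0" using y sol by (simp add: matrix_vector_mult_diff_distrib)
    then have ge: "Q \<le> (real (l0_norm (y - x)) - 1) * \<mu>2"
      unfolding Q_def \<alpha>_def \<beta>_def \<mu>t_def \<mu>_def \<mu>2_def
      using kernel_l0_norm_ge[OF nz] y by simp
    have "1 < CARD('n)" using assms(6,7) by simp
    then obtain i j :: 'n where "i \<noteq> j"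
      using card_le_Suc0_iff_eq[of "UNIV :: 'n set"] by auto
    then have "0 < \<mu>2"
      using sub_mutual_coherence_bounds(1)[of i j A] False by (simp add: \<mu>2_def)
    then have "Q / \<mu>2 \<le> real (l0_norm (y - x)) - 1"
      using ge by (simp add: pos_divide_le_eq)
    moreover have "real (l0_norm (y - x)) \<le> real (l0_norm y) + real (l0_norm x)"
      using l0_norm_diff_le[of y x] by linarith
    ultimately show ?thesis using sparse by linarith
  qed
  then show ?thesis using sol by (simp add: unique_sparsest_solution_def)
qed

end
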